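(* Let $n\geq 1$, $r\geq 0$ and $\mathbf{X}=(X_1,\dots,X_n)\sim\mu^n$. Define $$H(\mathbf{X},r)=\frac1n\sum_{k=1}^n \mu\Big(\bigcap_{i\in[n]:\, i\neq k}B(X_i,r)^c\Big).$$ Then (i) $\hat M(\mathbf{X},r)\leq H(\mathbf{X},r)\leq \hat M(\mathbf{X},r)+1/n$; (ii) $M(\mu,n,r)\leq \mathbb{E}[G(\mathbf{X},r)]\leq M(\mu,n,r)+1/n$; (iii) $\mathbb{V}[G(\mathbf{X},r)-H(\mathbf{X},r)]\leq 3/n$; (iv) $\|G(\mathbf{X},r)-\hat M(\mathbf{X},r)\|_2\leq\sqrt{7/n}$.
   Context: $\mathcal{X}$ is a Hausdorff space with Borel probability measure $\mu$ and a continuous function $d:\mathcal{X}\times\mathcal{X}\to[0,\infty)$ (a distortion function, not necessarily a metric) with $d(x,x)=0$ and $d(x,y)=d(y,x)$. $[n]=\{1,\dots,n\}$, $B(x,r)=\{y: d(x,y)\leq r\}$, and $A^c$ is the complement of $A$ in $\mathcal{X}$ (an empty intersection is $\mathcal{X}$). $X_1,\dots,X_n$ are independent with law $\mu$. The conditional missing mass is $\hat M(\mathbf{X},r)=\mu\big(\bigcap_{k\in[n]}B(X_k,r)^c\big)$, the expected missing mass is $M(\mu,n,r)=\mathbb{E}[\hat M(\mathbf{X},r)]$, and the Good-Turing estimator is $G(\mathbf{X},r)=\frac1n\sum_{k=1}^n\mathbf{1}\{X_k\in\bigcap_{i\in[n]:i\neq k}B(X_i,r)^c\}$. $\mathbb{V}$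 is variance and $\|Y\|_2=(\mathbb{E}[Y^2])^{1/2}$.
   Formalization: The formal statement additionally assumes that {(x,y): d(x,y) ≤ r} is measurable for the completion of μ×μ; on a general Hausdorff space this can fail, and then E[G] is undefined (already for n = 2). It is automatic on second countable spaces. *)

theory Defs
  imports "HOL-Probability.Probability"
begin

definition distortion :: "('a::topological_space \<Rightarrow> 'a \<Rightarrow> real) \<Rightarrow> bool" where
  "distortion d \<longleftrightarrow>
     continuous_on UNIV (\<lambda>(x, y). d x y) \<and>
     (\<forall>x y. 0 \<le> d x y) \<and> (\<forall>x. d x x = 0) \<and> (\<forall>x y. d x y = d y x)"

definition dist_ball :: "('a \<Rightarrow> 'a \<Rightarrow> real) \<Rightarrow> 'a \<Rightarrow> real \<Rightarrow> 'a set" where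
  "dist_ball d x r = {y. d x y \<le> r}"

text \<open>
  The points missed by the balls around the sample points with index in \<open>I\<close>;
  for \<open>I = {}\<close> this is the whole space.
\<close>

definition missed :: "('a \<Rightarrow> 'a \<Rightarrow> real) \<Rightarrow> nat set \<Rightarrow> (nat \<Rightarrow> 'a) \<Rightarrow> real \<Rightarrow> 'a set" where
  "missed d I x r = (\<Inter>i\<in>I. - dist_ball d (x i) r)"

definition cond_missing_mass ::
    "'a measure \<Rightarrow> ('a \<Rightarrow> 'a \<Rightarrow> real) \<Rightarrow> nat \<Rightarrow> (nat \<Rightarrow> 'a) \<Rightarrow> real \<Rightarrow> real" where
  "cond_missing_mass \<mu> d n x r = measure \<mu> (missed d {1..n} x r)"

definition good_turing ::
    "('a \<Rightarrow> 'a \<Rightarrow> real) \<Rightarrow> nat \<Rightarrow> (nat \<Rightarrow> 'a) \<Rightarrow> real \<Rightarrow> real" where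
  "good_turing d n x r =
     1 / real n * (\<Sum>k\<in>{1..n}. indicator (missed d ({1..n} - {k}) x r) (x k))"

definition loo_missing_mass ::
    "'a measure \<Rightarrow> ('a \<Rightarrow> 'a \<Rightarrow> real) \<Rightarrow> nat \<Rightarrow> (nat \<Rightarrow> 'a) \<Rightarrow> real \<Rightarrow> real" where
  "loo_missing_mass \<mu> d n x r =
     1 / real n * (\<Sum>k\<in>{1..n}. measure \<mu> (missed d ({1..n} - {k}) x r))"

text \<open>
  The Bochner integral of a non-measurable function is \<open>0\<close> by convention. Expectations are
  therefore taken with respect to completed measures; this changes nothing for measurable
  integrands.
\<close>

definition expected_missing_mass ::
    "'a measure \<Rightarrow> ('a \<Rightarrow> 'a \<Rightarrow> real) \<Rightarrow> nat \<Rightarrow> real \<Rightarrow> real" where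
  "expected_missing_mass \<mu> d n r =
     (\<integral>x. cond_missing_mass \<mu> d n x r \<partial>completion (PiM {1..n} (\<lambda>_. \<mu>)))"

definition L2_norm_rv :: "'b measure \<Rightarrow> ('b \<Rightarrow> real) \<Rightarrow> real" where
  "L2_norm_rv P Y = sqrt (prob_space.expectation P (\<lambda>\<omega>. (Y \<omega>)\<^sup>2))"

text \<open>
  On a general Hausdorff space, continuity of \<open>d\<close> makes \<open>{(x, y). d x y \<le> r}\<close> closed, hence
  Borel in the product topology, but not necessarily measurable for (the completion of) the
  product measure. For two sample points, the Good-Turing estimator is the indicator of the
  complement of this set, so its expectation is meaningful only if the set is measurable.
  The following predicate states this requirement; it holds automatically, for example, on
  second countable spaces.
\<close>

definition ball_relation_measurable ::
    "'a measure \<Rightarrow> ('a \<Rightarrow> 'a \<Rightarrow> real) \<Rightarrow> real \<Rightarrow> bool" where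
  "ball_relation_measurable \<mu> d r \<longleftrightarrow>
     {(x, y). d x y \<le> r} \<in> sets (completion (\<mu> \<Otimes>\<^sub>M \<mu>))"

lemma ball_relation_measurable_second_countable:
  fixes d :: "'a::second_countable_topology \<Rightarrow> 'a \<Rightarrow> real"
  assumes "sets \<mu> = sets borel" and "distortion d"
  shows "ball_relation_measurable \<mu> d r"
proof -
  have "closed {z. (\<lambda>(x, y). d x y) z \<le> r}"
    using assms(2) unfolding distortion_def
    by (intro closed_Collect_le continuous_on_const) auto
  moreover have "{z. (\<lambda>(x, y). d x y) z \<le> r} = {(x, y). d x y \<le> r}"
    by auto
  ultimately have "{(x, y). d x y \<le> r} \<in> sets (borel :: ('a \<times> 'a) measure)"
    by (metis borel_closed)
  moreover have "sets (\<mu> \<Otimes>\<^sub>M \<mu>) = sets (borel :: ('a \<times> 'a) measure)"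
    by (metis assms(1) borel_prod sets_pair_measure_cong)
  ultimately show ?thesis
    unfolding ball_relation_measurable_def by (simp add: sets_completionI_sets)
qed

end

theory Submission
  imports Defs
begin

text \<open>
  Put $A_k = 1\{X_k \in S_k\} - \mu(S_k)$, where $S_k$ is the set missed by the sample without
  $X_k$, so that $G - H$ is the mean of the $A_k$. Conditionally on the other points, $A_k$ is
  centred. For $k \neq l$ split $A_k = A'_k - D_{kl}$, where $A'_k$ is built from the sample
  without $X_k$ and $X_l$, and $D_{kl}$ is the centred indicator of the event that $X_k$ is covered
  by $X_l$ only. Centring removes every term of $E[A_k A_l]$ except $E[D_{kl} D_{lk}]$. Since
  at most one $l$ can be the only point covering $X_k$, the second moments of the $D_{kl}$ sum to
  at most $n$. This gives $E[(G - H)^2] \le 2/n$, and then (iv) follows from (i).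

  As the relation $d(x, y) \le r$ is measurable only for the completed product measure, the
  computation is carried out for a measurable relation $E$ that agrees with it almost everywhere.
\<close>

section \<open>Resampling one coordinate of a product measure\<close>

text \<open>Given the other coordinates, \<open>x k\<close> has law \<open>M\<close>. As
  \<open>F x\<close> does not depend on \<open>x k\<close>, a fresh independent point can take its
  place; this is Fubini with coordinate \<open>k\<close> split off.\<close>

lemma (in prob_space) integral_PiM_resample:
  fixes F :: "('i \<Rightarrow> 'a) \<Rightarrow> 'a \<Rightarrow> real"
  assumes I: "finite I" "k \<in> I"
    and F [measurable]: "case_prod F \<in> borel_measurable (PiM I (\<lambda>_. M) \<Otimes>\<^sub>M M)"
    and bound: "\<And>x y. x \<in> space (PiM I (\<lambda>_. M)) \<Longrightarrow> y \<in> space M \<Longrightarrow> \<bar>F x y\<bar> \<le> B"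
    and inv: "\<And>x y z. x \<in> space (PiM I (\<lambda>_. M)) \<Longrightarrow> y \<in> space M \<Longrightarrow> z \<in> space M \<Longrightarrow>
      F (x(k := z)) y = F x y"
  shows "(\<integral>x. F x (x k) \<partial>PiM I (\<lambda>_. M)) = (\<integral>x. (\<integral>y. F x y \<partial>M) \<partial>PiM I (\<lambda>_. M))"
proof -
  define J where "J = I - {k}"
  have J: "finite J" "k \<notin> J" and IJ: "I = insert k J"
    using I by (auto simp: J_def)
  interpret Q: product_prob_space "\<lambda>_. M" I ..
  let ?Q = "PiM I (\<lambda>_. M)"
  let ?g = "\<lambda>x. \<integral>y. F x y \<partial>M"
  have k_meas [measurable]: "(\<lambda>x. x k) \<in> ?Q \<rightarrow>\<^sub>M M"
    using I by measurable
  have sp: "x k \<in> space M" if "x \<in> space ?Q" for x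
    using that I by (auto simp: space_PiM)
  have bound_g: "\<bar>?g x\<bar> \<le> B" if "x \<in> space ?Q" for x
  proof -
    have [measurable]: "F x \<in> borel_measurable M"
      using measurable_compose_Pair1[OF that F] by simp
    have "integrable M (F x)"
      by (rule integrable_const_bound[where B = B]) (use bound that in auto)
    then have "\<bar>?g x\<bar> \<le> (\<integral>y. \<bar>F x y\<bar> \<partial>M)"
      by (intro integral_abs_bound)
    also have "\<dots> \<le> (\<integral>y. B \<partial>M)"
      using \<open>integrable M (F x)\<close> by (intro integral_mono) (use bound that in auto)
    finally show ?thesis by (simp add: prob_space)
  qed
  have "(\<integral>x. F x (x k) \<partial>?Q) = (\<integral>x. (\<integral>y. F (x(k := y)) ((x(k := y)) k) \<partial>M) \<partial>PiM J (\<lambda>_. M))"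
    unfolding IJ
  proof (rule Q.product_integral_insert[OF J], fold IJ, rule Q.P.integrable_const_bound)
    show "AE x in ?Q. norm (F x (x k)) \<le> B"
      using bound sp by auto
    show "(\<lambda>x. F x (x k)) \<in> borel_measurable ?Q"
      using measurable_compose[OF measurable_Pair[OF measurable_ident k_meas] F]
      by (simp add: id_def)
  qed
  also have "\<dots> = (\<integral>x. (\<integral>z. ?g (x(k := z)) \<partial>M) \<partial>PiM J (\<lambda>_. M))"
  proof (rule Bochner_Integration.integral_cong[OF refl])
    fix x assume x: "x \<in> space (PiM J (\<lambda>_. M))"
    \<comment> \<open>\<open>x\<close> is a point of the product over \<open>J\<close> only, so
      \<open>inv\<close> becomes applicable once some value \<open>c\<close> is put at
      \<open>k\<close>.\<close>
    obtain c where c: "c \<in> space M" using not_empty by auto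
    have xc: "x(k := c) \<in> space ?Q"
      using x c by (auto simp: space_PiM IJ PiE_def extensional_def)
    have eq: "F (x(k := z)) y = F (x(k := c)) y" if "y \<in> space M" "z \<in> space M" for y z
      using inv[OF xc that] by simp
    have "(\<integral>y. F (x(k := y)) ((x(k := y)) k) \<partial>M) = ?g (x(k := c))"
      by (rule Bochner_Integration.integral_cong[OF refl]) (simp add: eq)
    also have "\<dots> = (\<integral>z. ?g (x(k := c)) \<partial>M)"
      by (simp add: prob_space)
    also have "\<dots> = (\<integral>z. ?g (x(k := z)) \<partial>M)"
      by (intro Bochner_Integration.integral_cong refl) (simp add: eq)
    finally show "(\<integral>y. F (x(k := y)) ((x(k := y)) k) \<partial>M) = (\<integral>z. ?g (x(k := z)) \<partial>M)" .
  qed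
  also have "\<dots> = (\<integral>x. ?g x \<partial>?Q)"
    unfolding IJ
  proof (rule Q.product_integral_insert[OF J, symmetric], fold IJ, rule Q.P.integrable_const_bound)
    show "AE x in ?Q. norm (?g x) \<le> B"
      using bound_g by auto
    show "?g \<in> borel_measurable ?Q"
      by measurable
  qed
  finally show ?thesis .
qed

section \<open>Hits, masses and centred deviations of a sample\<close>

text \<open>A pair \<open>(x, y)\<close> in \<open>E\<close> is read as: the sample point
  \<open>x\<close> covers \<open>y\<close>.\<close>

locale relation_sample = prob_space M for M :: "'a measure" +
  fixes E :: "('a \<times> 'a) set" and I :: "'i set"
  assumes E [measurable]: "E \<in> sets (M \<Otimes>\<^sub>M M)"
    and finite_I: "finite I"
begin

abbreviation Q :: "('i \<Rightarrow> 'a) measure" where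
  "Q \<equiv> PiM I (\<lambda>_. M)"

sublocale Q: product_prob_space "\<lambda>_. M" I ..

text \<open>This pointwise invariance says that the random set \<open>A\<close> does not depend on
  \<open>X_k\<close>; it is what permits resampling \<open>X_k\<close>.\<close>

definition ignores :: "'i \<Rightarrow> (('i \<Rightarrow> 'a) \<times> 'a) set \<Rightarrow> bool" where
  "ignores k A \<longleftrightarrow>
    (\<forall>x\<in>space Q. \<forall>y\<in>space M. \<forall>z\<in>space M. (x(k := z), y) \<in> A \<longleftrightarrow> (x, y) \<in> A)"

text \<open>A set \<open>A\<close> of pairs encodes a random set: its section at the sample
  \<open>x\<close> is the set of all \<open>y\<close> with \<open>(x, y)\<close> in
  \<open>A\<close>.\<close>

definition hit :: "(('i \<Rightarrow> 'a) \<times> 'a) set \<Rightarrow> 'i \<Rightarrow> ('i \<Rightarrow> 'a) \<Rightarrow> real" where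
  "hit A k x = indicator A (x, x k)"

definition mass :: "(('i \<Rightarrow> 'a) \<times> 'a) set \<Rightarrow> ('i \<Rightarrow> 'a) \<Rightarrow> real" where
  "mass A x = measure M (Pair x -` A)"

definition dev :: "(('i \<Rightarrow> 'a) \<times> 'a) set \<Rightarrow> 'i \<Rightarrow> ('i \<Rightarrow> 'a) \<Rightarrow> real" where
  "dev A k x = hit A k x - mass A x"

lemma measurable_hit [measurable]:
  assumes "A \<in> sets (Q \<Otimes>\<^sub>M M)" "k \<in> I"
  shows "hit A k \<in> borel_measurable Q"
proof -
  have "(\<lambda>x. (x, x k)) \<in> Q \<rightarrow>\<^sub>M Q \<Otimes>\<^sub>M M"
    using assms(2) by measurable
  from measurable_compose[OF this borel_measurable_indicator[OF assms(1)]]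
  show ?thesis by (simp add: hit_def[abs_def])
qed

lemma measurable_mass [measurable]:
  assumes "A \<in> sets (Q \<Otimes>\<^sub>M M)"
  shows "mass A \<in> borel_measurable Q"
  using measurable_emeasure_Pair[OF assms] unfolding mass_def[abs_def] measure_def by measurable

lemma measurable_dev [measurable]:
  assumes "A \<in> sets (Q \<Otimes>\<^sub>M M)" "k \<in> I"
  shows "dev A k \<in> borel_measurable Q"
  using assms unfolding dev_def[abs_def] by measurable

lemma hit_bounds: "0 \<le> hit A k x" "hit A k x \<le> 1"
  by (auto simp: hit_def indicator_def)

lemma mass_bounds: "0 \<le> mass A x" "mass A x \<le> 1"
  by (auto simp: mass_def)

lemma abs_dev_le: "\<bar>dev A k x\<bar> \<le> 1"
  using hit_bounds[of A k x] mass_bounds[of A x] unfolding dev_def by linarith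

lemma integrable_bounded:
  fixes f :: "('i \<Rightarrow> 'a) \<Rightarrow> real"
  assumes "f \<in> borel_measurable Q" "\<And>x. x \<in> space Q \<Longrightarrow> \<bar>f x\<bar> \<le> B"
  shows "integrable Q f"
  using assms by (intro Q.P.integrable_const_bound[where B = B]) auto

lemma mass_ignores:
  assumes "A \<in> sets (Q \<Otimes>\<^sub>M M)" "ignores k A" "k \<in> I" "x \<in> space Q" "z \<in> space M"
  shows "mass A (x(k := z)) = mass A x"
proof -
  have "Pair (x(k := z)) -` A = Pair x -` A"
    using assms sets.sets_into_space[OF assms(1)]
    by (fastforce simp: ignores_def space_pair_measure)
  then show ?thesis by (simp add: mass_def)
qed

section \<open>Orthogonality of centred deviations\<close>

text \<open>Given all coordinates except \<open>k\<close>, both \<open>Z\<close> and the section of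
  \<open>A\<close> are fixed, and the event that \<open>X_k\<close> lies in the section has
  conditional probability \<open>mass A\<close>. So \<open>dev A k\<close> has conditional mean
  0.\<close>

lemma integral_mult_dev_eq_0:
  assumes A [measurable]: "A \<in> sets (Q \<Otimes>\<^sub>M M)" and k: "k \<in> I" and ign: "ignores k A"
    and Z [measurable]: "Z \<in> borel_measurable Q"
    and bound: "\<And>x. x \<in> space Q \<Longrightarrow> \<bar>Z x\<bar> \<le> B"
    and inv: "\<And>x z. x \<in> space Q \<Longrightarrow> z \<in> space M \<Longrightarrow> Z (x(k := z)) = Z x"
  shows "(\<integral>x. Z x * dev A k x \<partial>Q) = 0"
proof -
  define F where "F = (\<lambda>x y. Z x * (indicator A (x, y) - mass A x))"
  have "(\<integral>x. F x (x k) \<partial>Q) = (\<integral>x. (\<integral>y. F x y \<partial>M) \<partial>Q)"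
  proof (rule integral_PiM_resample[OF finite_I k, where B = B])
    show "case_prod F \<in> borel_measurable (Q \<Otimes>\<^sub>M M)"
      unfolding F_def by measurable
  next
    fix x y assume "x \<in> space Q" "y \<in> space M"
    have "\<bar>indicator A (x, y) - mass A x\<bar> \<le> 1"
      using mass_bounds[of A x] by (auto simp: indicator_def)
    then have "\<bar>Z x\<bar> * \<bar>indicator A (x, y) - mass A x\<bar> \<le> B * 1"
      using bound[OF \<open>x \<in> space Q\<close>] by (intro mult_mono) auto
    then show "\<bar>F x y\<bar> \<le> B" by (simp add: F_def abs_mult)
  next
    fix x y z assume "x \<in> space Q" "y \<in> space M" "z \<in> space M"
    then show "F (x(k := z)) y = F x y"
      using ign mass_ignores[OF A ign k] inv by (auto simp: F_def ignores_def indicator_def)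
  qed
  also have "\<dots> = (\<integral>x. 0 \<partial>Q)"
  proof (rule Bochner_Integration.integral_cong[OF refl])
    fix x assume x: "x \<in> space Q"
    have *: "Pair x -` A \<in> sets M"
      using A by (rule sets_Pair1)
    have "(\<integral>y. F x y \<partial>M) = Z x * (\<integral>y. indicator (Pair x -` A) y - mass A x \<partial>M)"
      unfolding F_def by (subst integral_mult_right_zero[symmetric]) (simp add: indicator_def)
    also have "(\<integral>y. indicator (Pair x -` A) y - mass A x \<partial>M) = 0"
      using * by (subst Bochner_Integration.integral_diff)
        (auto simp: mass_def prob_space integrable_indicator_iff emeasure_eq_measure)
    finally show "(\<integral>y. F x y \<partial>M) = 0" by simp
  qed
  finally show ?thesis by (simp add: F_def dev_def hit_def)
qed

lemma integral_dev_eq_0: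
  assumes "A \<in> sets (Q \<Otimes>\<^sub>M M)" "k \<in> I" "ignores k A"
  shows "(\<integral>x. dev A k x \<partial>Q) = 0"
  using integral_mult_dev_eq_0[OF assms, of "\<lambda>_. 1" 1] by simp

text \<open>The conditional variance of an indicator with success probability p is p - p^2, hence at
  most p.\<close>

lemma integral_dev_square_le:
  assumes A [measurable]: "A \<in> sets (Q \<Otimes>\<^sub>M M)" and k [measurable]: "k \<in> I" and ign: "ignores k A"
  shows "(\<integral>x. (dev A k x)\<^sup>2 \<partial>Q) \<le> (\<integral>x. hit A k x \<partial>Q)"
proof -
  \<comment> \<open>\<open>hit\<close> equals its own square. The terms are sorted so that the last
    one is orthogonal: \<open>mass A\<close> does not depend on \<open>X_k\<close>.\<close>
  have *: "(dev A k x)\<^sup>2 = hit A k x - (mass A x)\<^sup>2 - 2 * (mass A x * dev A k x)" for x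
    by (auto simp: dev_def hit_def indicator_def power2_eq_square algebra_simps)
  have md: "\<bar>mass A x * dev A k x\<bar> \<le> 1" for x
    using mult_mono[OF mass_bounds(2)[of A x] abs_dev_le[of A k x]] mass_bounds[of A x]
    by (simp add: abs_mult)
  have "(\<integral>x. (dev A k x)\<^sup>2 \<partial>Q) \<le> (\<integral>x. hit A k x - 2 * (mass A x * dev A k x) \<partial>Q)"
  proof (rule integral_mono)
    show "integrable Q (\<lambda>x. (dev A k x)\<^sup>2)"
      by (rule integrable_bounded[where B = 1]) (use abs_dev_le in \<open>auto simp: abs_square_le_1\<close>)
    show "integrable Q (\<lambda>x. hit A k x - 2 * (mass A x * dev A k x))"
      by (intro Bochner_Integration.integrable_diff integrable_mult_right integrable_bounded[where B = 1])
        (use hit_bounds md in auto)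
    show "(dev A k x)\<^sup>2 \<le> hit A k x - 2 * (mass A x * dev A k x)" for x
      unfolding * by simp
  qed
  also have "\<dots> = (\<integral>x. hit A k x \<partial>Q) - 2 * (\<integral>x. mass A x * dev A k x \<partial>Q)"
    by (subst Bochner_Integration.integral_diff)
      (auto intro!: integrable_bounded[where B = 1] simp: hit_bounds md)
  also have "(\<integral>x. mass A x * dev A k x \<partial>Q) = 0"
    by (rule integral_mult_dev_eq_0[OF A k ign, where B = 1])
      (use mass_bounds mass_ignores[OF A ign k] in auto)
  finally show ?thesis by simp
qed

section \<open>Points left uncovered and points covered only once\<close>

text \<open>The counterpart of \<open>missed\<close> for the relation \<open>E\<close>, cut down to
  the product space so that it can be a measurable set.\<close>

definition uncovered :: "'i set \<Rightarrow> (('i \<Rightarrow> 'a) \<times> 'a) set" where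
  "uncovered J = {p \<in> space (Q \<Otimes>\<^sub>M M). \<forall>i\<in>J. (fst p i, snd p) \<notin> E}"

definition covered_only_by :: "'i \<Rightarrow> 'i set \<Rightarrow> (('i \<Rightarrow> 'a) \<times> 'a) set" where
  "covered_only_by l J = {p \<in> uncovered (J - {l}). (fst p l, snd p) \<in> E}"

lemma sets_relation:
  assumes "i \<in> I" shows "{p \<in> space (Q \<Otimes>\<^sub>M M). (fst p i, snd p) \<in> E} \<in> sets (Q \<Otimes>\<^sub>M M)"
  using assms by measurable

lemma sets_uncovered [measurable]:
  assumes "J \<subseteq> I" shows "uncovered J \<in> sets (Q \<Otimes>\<^sub>M M)"
proof -
  have fin: "finite J" using assms finite_I by (rule finite_subset)
  have "uncovered J = {p \<in> space (Q \<Otimes>\<^sub>M M). \<forall>i\<in>J. \<not> (fst p i, snd p) \<in> E}"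
    by (simp add: uncovered_def)
  also have "\<dots> \<in> sets (Q \<Otimes>\<^sub>M M)"
    using assms by (intro sets.sets_Collect_finite_All sets.sets_Collect_neg sets_relation fin) auto
  finally show ?thesis .
qed

lemma sets_covered_only_by [measurable]:
  assumes "J \<subseteq> I" "l \<in> I" shows "covered_only_by l J \<in> sets (Q \<Otimes>\<^sub>M M)"
proof -
  have "covered_only_by l J = uncovered (J - {l}) \<inter> {p \<in> space (Q \<Otimes>\<^sub>M M). (fst p l, snd p) \<in> E}"
    by (auto simp: covered_only_by_def uncovered_def)
  also have "\<dots> \<in> sets (Q \<Otimes>\<^sub>M M)"
    using assms by (intro sets.Int sets_uncovered sets_relation) auto
  finally show ?thesis .
qed

lemma fun_upd_in_space:
  "k \<in> I \<Longrightarrow> x \<in> space Q \<Longrightarrow> z \<in> space M \<Longrightarrow> x(k := z) \<in> space Q"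
  by (auto simp: space_PiM PiE_def extensional_def)

lemma ignores_uncovered: "k \<in> I \<Longrightarrow> k \<notin> J \<Longrightarrow> ignores k (uncovered J)"
  by (auto simp: ignores_def uncovered_def space_pair_measure fun_upd_in_space)

lemma ignores_covered_only_by:
  "k \<in> I \<Longrightarrow> k \<notin> J \<Longrightarrow> k \<noteq> l \<Longrightarrow> ignores k (covered_only_by l J)"
  using ignores_uncovered[of k "J - {l}"] by (auto simp: ignores_def covered_only_by_def)

text \<open>The sample point \<open>l\<close> removes from the set missed by the others exactly the
  points that it alone covers. Both \<open>hit\<close> and \<open>mass\<close> are additive over
  this disjoint decomposition.\<close>

lemma dev_uncovered_split:
  assumes "J \<subseteq> I" "l \<in> J" "k \<in> I" "x \<in> space Q"
  shows "dev (uncovered J) k x = dev (uncovered (J - {l})) k x - dev (covered_only_by l J) k x"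
proof -
  have eq: "uncovered J = uncovered (J - {l}) - covered_only_by l J"
    using assms(2) by (auto simp: uncovered_def covered_only_by_def)
  have sub: "covered_only_by l J \<subseteq> uncovered (J - {l})"
    by (auto simp: covered_only_by_def)
  have [measurable]: "uncovered (J - {l}) \<in> sets (Q \<Otimes>\<^sub>M M)" "covered_only_by l J \<in> sets (Q \<Otimes>\<^sub>M M)"
    using assms by (auto intro!: sets_uncovered sets_covered_only_by)
  have "mass (uncovered J) x = mass (uncovered (J - {l})) x - mass (covered_only_by l J) x"
    unfolding mass_def eq vimage_Diff using sub
    by (intro finite_measure_Diff sets_Pair1[where ?M1.0 = Q]) auto
  moreover have "hit (uncovered J) k x = hit (uncovered (J - {l})) k x - hit (covered_only_by l J) k x"
    unfolding hit_def eq using sub by (auto simp: indicator_def)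
  ultimately show ?thesis by (simp add: dev_def)
qed

text \<open>The events exclude each other: if \<open>l\<close> alone covers \<open>x k\<close>, no
  other index of \<open>J\<close> covers it.\<close>

lemma sum_hit_covered_only_by_le_1:
  assumes "finite J"
  shows "(\<Sum>l\<in>J. hit (covered_only_by l J) k x) \<le> 1"
proof (cases "\<exists>l\<in>J. (x, x k) \<in> covered_only_by l J")
  case True
  then obtain l where l: "l \<in> J" "(x, x k) \<in> covered_only_by l J" by auto
  have "(\<Sum>l\<in>J. hit (covered_only_by l J) k x) = (\<Sum>l'\<in>{l}. hit (covered_only_by l' J) k x)"
    using l assms by (intro sum.mono_neutral_right)
      (auto simp: hit_def indicator_def covered_only_by_def uncovered_def)
  then show ?thesis using hit_bounds(2) by simp
next
  case False
  then show ?thesis by (simp add: hit_def indicator_def)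
qed

section \<open>Covariances and the second moment of the sum\<close>

text \<open>Here \<open>p k l\<close> is the probability that \<open>X_l\<close> is the only other
  sample point covering \<open>X_k\<close>. Splitting both factors gives (a - c)(b - e), of which
  only ce survives integration.\<close>

lemma integral_dev_mult_dev_le:
  assumes k: "k \<in> I" and l: "l \<in> I" and kl: "k \<noteq> l"
  defines "p \<equiv> \<lambda>k l. \<integral>x. hit (covered_only_by l (I - {k})) k x \<partial>Q"
  shows "(\<integral>x. dev (uncovered (I - {k})) k x * dev (uncovered (I - {l})) l x \<partial>Q) \<le> (p k l + p l k) / 2"
proof -
  define S where "S = I - {k} - {l}"
  have S': "S = I - {l} - {k}" by (auto simp: S_def)
  define a b c e where "a = dev (uncovered S) k" and "b = dev (uncovered S) l"
    and "c = dev (covered_only_by l (I - {k})) k" and "e = dev (covered_only_by k (I - {l})) l"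
  have S_sub: "S \<subseteq> I" by (auto simp: S_def)
  note [measurable] = sets_uncovered[OF S_sub] sets_covered_only_by[of "I - {k}" l, OF _ l, simplified]
    sets_covered_only_by[of "I - {l}" k, OF _ k, simplified] k l
  have [measurable]: "a \<in> borel_measurable Q" "b \<in> borel_measurable Q"
    "c \<in> borel_measurable Q" "e \<in> borel_measurable Q"
    unfolding a_def b_def c_def e_def by measurable
  have bound: "\<bar>a x\<bar> \<le> 1" "\<bar>b x\<bar> \<le> 1" "\<bar>c x\<bar> \<le> 1" "\<bar>e x\<bar> \<le> 1" for x
    unfolding a_def b_def c_def e_def by (rule abs_dev_le)+
  have prod_int: "integrable Q (\<lambda>x. f x * g x)"
    if [measurable]: "f \<in> borel_measurable Q" "g \<in> borel_measurable Q"
      and "\<And>x. \<bar>f x\<bar> \<le> 1" "\<And>x. \<bar>g x\<bar> \<le> 1" for f g :: "('i \<Rightarrow> 'a) \<Rightarrow> real"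
    using that(3,4) by (intro integrable_bounded[where B = 1]) (auto simp: abs_mult intro: mult_le_one)
  have ign: "ignores k (uncovered S)" "ignores l (uncovered S)"
    "ignores k (covered_only_by l (I - {k}))" "ignores l (covered_only_by k (I - {l}))"
    using k l kl by (auto intro!: ignores_uncovered ignores_covered_only_by simp: S_def)
  \<comment> \<open>\<open>a\<close> reads coordinate \<open>k\<close> but not \<open>l\<close>, and
    \<open>b\<close> reads \<open>l\<close> but not \<open>k\<close>, since \<open>S\<close> omits
    both indices.\<close>
  have dev_inv: "dev (uncovered S) i (x(j := z)) = dev (uncovered S) i x"
    if "ignores j (uncovered S)" "j \<in> I" "i \<in> I" "i \<noteq> j" "x \<in> space Q" "z \<in> space M" for i j x z
  proof -
    have "x i \<in> space M" using that by (auto simp: space_PiM)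
    then show ?thesis
      using that mass_ignores[OF sets_uncovered[OF S_sub] that(1,2,5,6)]
      by (auto simp: dev_def hit_def ignores_def indicator_def)
  qed
  \<comment> \<open>\<open>b\<close> and \<open>e\<close> are centred in \<open>X_l\<close>, on
    which \<open>a\<close> does not depend; \<open>c\<close> is centred in \<open>X_k\<close>, on
    which \<open>b\<close> does not depend.\<close>
  have ab: "(\<integral>x. a x * b x \<partial>Q) = 0" unfolding b_def
    by (rule integral_mult_dev_eq_0[where B = 1])
      (use bound dev_inv[OF ign(2)] k l kl ign in \<open>auto simp: a_def intro!: sets_uncovered S_sub measurable_dev abs_dev_le\<close>)
  have ae: "(\<integral>x. a x * e x \<partial>Q) = 0" unfolding e_def
    by (rule integral_mult_dev_eq_0[where B = 1])
      (use bound dev_inv[OF ign(2)] k l kl ign in \<open>auto simp: a_def intro!: sets_covered_only_by sets_uncovered S_sub measurable_dev abs_dev_le\<close>)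
  have bc: "(\<integral>x. b x * c x \<partial>Q) = 0" unfolding c_def
    by (rule integral_mult_dev_eq_0[where B = 1])
      (use bound dev_inv[OF ign(1)] k l kl ign in \<open>auto simp: b_def intro!: sets_covered_only_by sets_uncovered S_sub measurable_dev abs_dev_le\<close>)
  have "(\<integral>x. dev (uncovered (I - {k})) k x * dev (uncovered (I - {l})) l x \<partial>Q)
      = (\<integral>x. a x * b x - a x * e x - b x * c x + c x * e x \<partial>Q)"
  proof (rule Bochner_Integration.integral_cong[OF refl])
    fix x assume x: "x \<in> space Q"
    have "dev (uncovered (I - {k})) k x = a x - c x"
      unfolding a_def c_def S_def using k l kl x by (intro dev_uncovered_split) auto
    moreover have "dev (uncovered (I - {l})) l x = b x - e x"
      unfolding b_def e_def S' using k l kl x by (intro dev_uncovered_split) auto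
    ultimately show "dev (uncovered (I - {k})) k x * dev (uncovered (I - {l})) l x
        = a x * b x - a x * e x - b x * c x + c x * e x"
      by (simp only:) (simp add: algebra_simps)
  qed
  also have "\<dots> = (\<integral>x. c x * e x \<partial>Q)"
    using prod_int bound ab ae bc by simp
  \<comment> \<open>Orthogonality does not apply to this term, as \<open>c\<close> may depend on
    \<open>X_l\<close> and \<open>e\<close> on \<open>X_k\<close>. The inequality 2ce <= c^2 + e^2
    reduces it to second moments.\<close>
  also have "\<dots> \<le> (\<integral>x. ((c x)\<^sup>2 + (e x)\<^sup>2) / 2 \<partial>Q)"
  proof (rule integral_mono)
    show "c x * e x \<le> ((c x)\<^sup>2 + (e x)\<^sup>2) / 2" for x
      using sum_squares_bound[of "c x" "e x"] by simp
  qed (use prod_int bound in \<open>auto simp: power2_eq_square\<close>)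
  also have "\<dots> = ((\<integral>x. (c x)\<^sup>2 \<partial>Q) + (\<integral>x. (e x)\<^sup>2 \<partial>Q)) / 2"
    using prod_int bound by (simp add: power2_eq_square)
  also have "\<dots> \<le> (p k l + p l k) / 2"
    unfolding p_def c_def e_def
    by (intro divide_right_mono add_mono integral_dev_square_le) (use k l ign in auto)
  finally show ?thesis .
qed

text \<open>The diagonal contributes at most 1 per index because deviations are bounded by 1. By
  symmetry the other terms contribute at most the sum of all \<open>p k l\<close> with k and l
  distinct, which is again at most 1 for each k.\<close>

lemma integral_sum_dev_square_le:
  "(\<integral>x. (\<Sum>k\<in>I. dev (uncovered (I - {k})) k x)\<^sup>2 \<partial>Q) \<le> 2 * real (card I)"
proof -
  let ?d = "\<lambda>k. dev (uncovered (I - {k})) k"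
  define p where "p = (\<lambda>k l. \<integral>x. hit (covered_only_by l (I - {k})) k x \<partial>Q)"
  \<comment> \<open>With zeros on the diagonal the double sums run over all of \<open>I\<close>, so
    that \<open>sum.swap\<close> can exchange the two indices.\<close>
  define q where "q = (\<lambda>k l. if l = k then 0 else p k l)"
  have d_meas [measurable]: "?d k \<in> borel_measurable Q" if "k \<in> I" for k
    using that by (intro measurable_dev sets_uncovered) auto
  have d_int: "integrable Q (\<lambda>x. ?d k x * ?d l x)" if "k \<in> I" "l \<in> I" for k l
    using that abs_dev_le
    by (intro integrable_bounded[where B = 1]) (auto simp: abs_mult intro: mult_le_one)
  have diag: "(\<integral>x. ?d k x * ?d k x \<partial>Q) \<le> 1" if "k \<in> I" for k
  proof -
    have "(\<integral>x. ?d k x * ?d k x \<partial>Q) \<le> (\<integral>x. 1 \<partial>Q)"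
      using abs_dev_le d_int[OF that that]
      by (intro integral_mono) (auto simp flip: power2_eq_square simp: abs_square_le_1)
    then show ?thesis by (simp add: Q.P.prob_space)
  qed
  have q_sum: "(\<Sum>l\<in>I. q k l) \<le> 1" if k: "k \<in> I" for k
  proof -
    have h_int: "integrable Q (hit (covered_only_by l (I - {k})) k)" if "l \<in> I" for l
      using that k hit_bounds
      by (intro integrable_bounded[where B = 1] measurable_hit sets_covered_only_by) auto
    have "(\<Sum>l\<in>I. q k l) = (\<Sum>l\<in>I - {k}. p k l)"
      using finite_I k by (simp add: sum.remove[of I k] q_def)
    also have "\<dots> = (\<integral>x. (\<Sum>l\<in>I - {k}. hit (covered_only_by l (I - {k})) k x) \<partial>Q)"
      unfolding p_def using h_int by (subst Bochner_Integration.integral_sum) auto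
    also have "\<dots> \<le> (\<integral>x. 1 \<partial>Q)"
      using h_int finite_I by (intro integral_mono sum_hit_covered_only_by_le_1) auto
    finally show ?thesis by (simp add: Q.P.prob_space)
  qed
  have "(\<integral>x. (\<Sum>k\<in>I. ?d k x)\<^sup>2 \<partial>Q) = (\<Sum>k\<in>I. \<Sum>l\<in>I. \<integral>x. ?d k x * ?d l x \<partial>Q)"
    unfolding power2_eq_square sum_product using d_int
    by (simp add: Bochner_Integration.integral_sum)
  also have "\<dots> \<le> (\<Sum>k\<in>I. \<Sum>l\<in>I. (if l = k then 1 else 0) + (q k l + q l k) / 2)"
  proof (intro sum_mono)
    fix k l assume "k \<in> I" "l \<in> I"
    then show "(\<integral>x. ?d k x * ?d l x \<partial>Q) \<le> (if l = k then 1 else 0) + (q k l + q l k) / 2"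
      using diag[of k] integral_dev_mult_dev_le[of k l] by (auto simp: q_def p_def)
  qed
  also have "\<dots> = real (card I) + ((\<Sum>k\<in>I. \<Sum>l\<in>I. q k l) + (\<Sum>k\<in>I. \<Sum>l\<in>I. q l k)) / 2"
    using finite_I by (simp add: sum.distrib sum_divide_distrib add_divide_distrib)
  also have "(\<Sum>k\<in>I. \<Sum>l\<in>I. q l k) = (\<Sum>k\<in>I. \<Sum>l\<in>I. q k l)"
    by (rule sum.swap)
  also have "real (card I) + ((\<Sum>k\<in>I. \<Sum>l\<in>I. q k l) + (\<Sum>k\<in>I. \<Sum>l\<in>I. q k l)) / 2
      \<le> real (card I) + (\<Sum>k\<in>I. 1)"
    using sum_mono[OF q_sum] by simp
  finally show ?thesis by simp
qed

end

section \<open>Completed measures and null sets of products\<close>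

text \<open>The estimators are known to agree only almost everywhere with measurable functions.
  Completeness turns this agreement into measurability, and the integral can then be computed with
  \<open>g\<close>.\<close>

lemma integral_completion_distr_AE:
  fixes f g :: "'b \<Rightarrow> real"
  assumes V: "V \<in> P \<rightarrow>\<^sub>M N" and Q: "distr P N V = Q"
    and g: "g \<in> borel_measurable Q" and ae: "AE x in Q. f x = g x"
  shows "(\<integral>\<omega>. f (V \<omega>) \<partial>completion P) = (\<integral>x. g x \<partial>Q)"
proof -
  have g': "g \<in> borel_measurable N"
    using g Q by (metis measurable_distr_eq1)
  have gV: "(\<lambda>\<omega>. g (V \<omega>)) \<in> borel_measurable P"
    using V g' by measurable
  have aeP: "AE \<omega> in completion P. f (V \<omega>) = g (V \<omega>)"
    using AE_distrD[OF V] ae Q by (intro AE_completion) blast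
  \<comment> \<open>In a complete measure, a set that agrees almost everywhere with a measurable set
    is measurable.\<close>
  have fV: "(\<lambda>\<omega>. f (V \<omega>)) \<in> borel_measurable (completion P)"
  proof (rule measurableI)
    fix A :: "real set" assume A: "A \<in> sets borel"
    have "(\<lambda>\<omega>. g (V \<omega>)) -` A \<inter> space (completion P) \<in> sets (completion P)"
      by (rule measurable_sets[OF measurable_completion[OF gV] A])
    then show "(\<lambda>\<omega>. f (V \<omega>)) -` A \<inter> space (completion P) \<in> sets (completion P)"
      by (rule completion.in_sets_AE[rotated]) (use aeP in auto)
  qed simp
  have "(\<integral>\<omega>. f (V \<omega>) \<partial>completion P) = (\<integral>\<omega>. g (V \<omega>) \<partial>completion P)"
    by (rule integral_cong_AE[OF fV measurable_completion[OF gV] aeP])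
  also have "\<dots> = (\<integral>\<omega>. g (V \<omega>) \<partial>P)"
    by (rule integral_completion[OF gV])
  also have "\<dots> = (\<integral>x. g x \<partial>Q)"
    unfolding Q[symmetric] by (rule integral_distr[OF V g', symmetric])
  finally show ?thesis .
qed

context prob_space
begin

text \<open>Fubini gives the claim for almost every first component, and coordinate \<open>i\<close>
  of the product has law \<open>M\<close>.\<close>

lemma AE_PiM_section:
  assumes "i \<in> I" and "AE p in M \<Otimes>\<^sub>M M. R p"
  shows "AE x in PiM I (\<lambda>_. M). AE y in M. R (x i, y)"
proof -
  note ps = prob_space_axioms
  interpret pair_prob_space M M ..
  show ?thesis
    by (rule AE_PiM_component[where P = "\<lambda>z. AE y in M. R (z, y)"])
      (use assms AE_pair ps in auto)
qed

text \<open>Resampling coordinate \<open>k\<close> replaces the indicator of a null set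
  \<open>N\<close> at \<open>(x i, x k)\<close> by the measure of the section of \<open>N\<close> at
  \<open>x i\<close>, which vanishes almost everywhere.\<close>

lemma AE_PiM_pair:
  assumes I: "finite I" "i \<in> I" "k \<in> I" "i \<noteq> k" and ae: "AE p in M \<Otimes>\<^sub>M M. R p"
  shows "AE x in PiM I (\<lambda>_. M). R (x i, x k)"
proof -
  interpret Q: product_prob_space "\<lambda>_. M" I ..
  let ?Q = "PiM I (\<lambda>_. M)"
  obtain N where N: "{p \<in> space (M \<Otimes>\<^sub>M M). \<not> R p} \<subseteq> N" "N \<in> null_sets (M \<Otimes>\<^sub>M M)"
    using ae by (auto simp: eventually_ae_filter)
  have [measurable]: "N \<in> sets (M \<Otimes>\<^sub>M M)" using N by auto
  have comp [measurable]: "(\<lambda>x. x i) \<in> ?Q \<rightarrow>\<^sub>M M" "(\<lambda>x. x k) \<in> ?Q \<rightarrow>\<^sub>M M"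
    using I by auto
  have int: "integrable ?Q (\<lambda>x. indicat_real N (x i, x k))"
    by (rule Q.P.integrable_const_bound[where B = 1]) auto
  have "(\<integral>x. indicat_real N (x i, x k) \<partial>?Q) = (\<integral>x. (\<integral>y. indicat_real N (x i, y) \<partial>M) \<partial>?Q)"
    by (rule integral_PiM_resample[OF I(1,3), where B = 1]) (use I in auto)
  also have "\<dots> = (\<integral>x. 0 \<partial>?Q)"
  proof (rule integral_cong_AE)
    show "AE x in ?Q. (\<integral>y. indicat_real N (x i, y) \<partial>M) = 0"
      using AE_PiM_section[OF I(2) AE_not_in[OF N(2)]]
    proof eventually_elim
      case (elim x)
      then show ?case
        by (intro integral_eq_zero_AE) (auto elim!: eventually_mono)
    qed
  qed simp_all
  finally have "AE x in ?Q. indicat_real N (x i, x k) = 0"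
    using integral_nonneg_eq_0_iff_AE[OF int] by simp
  with AE_space show ?thesis
  proof eventually_elim
    case (elim x)
    then have "(x i, x k) \<in> space (M \<Otimes>\<^sub>M M)"
      using I by (auto simp: space_pair_measure space_PiM)
    with elim N show ?case by (auto simp: indicator_def split: if_splits)
  qed
qed

end

section \<open>Missed sets and the leave-one-out mass\<close>

lemma dist_ball_closed:
  assumes "distortion d" shows "closed (dist_ball d x r)"
proof -
  have "continuous_on UNIV (\<lambda>(x, y). d x y)"
    using assms by (simp add: distortion_def)
  from continuous_on_compose2[OF this continuous_on_Pair[OF continuous_on_const continuous_on_id]]
  have "continuous_on UNIV (d x)" by simp
  then show ?thesis
    unfolding dist_ball_def by (intro closed_Collect_le continuous_on_const)
qed

lemma sets_missed:
  assumes "distortion d" "sets \<mu> = sets borel" "finite J"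
  shows "missed d J x r \<in> sets \<mu>"
proof -
  have "open (missed d J x r)"
    unfolding missed_def using assms dist_ball_closed[OF assms(1)]
    by (intro open_INT) auto
  then show ?thesis using assms by simp
qed

lemma missed_cong: "(\<And>i. i \<in> J \<Longrightarrow> x i = y i) \<Longrightarrow> missed d J x r = missed d J y r"
  by (auto simp: missed_def)

text \<open>Leaving out point k enlarges the missed set by the points covered by k alone. These
  increments are disjoint for different k, so their masses sum to at most 1, and averaging gives
  1/n.\<close>

lemma missing_mass_leave_one_out:
  assumes "prob_space M" and "distortion d" "sets M = sets borel" "n \<ge> 1"
  shows "cond_missing_mass M d n x r \<le> loo_missing_mass M d n x r"
    and "loo_missing_mass M d n x r \<le> cond_missing_mass M d n x r + 1 / real n"
proof -
  interpret prob_space M by fact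
  let ?I = "{1..n}"
  let ?S = "\<lambda>k. missed d (?I - {k}) x r"
  let ?T = "missed d ?I x r"
  have meas: "missed d J x r \<in> events" if "J \<subseteq> ?I" for J
    using that by (intro sets_missed[OF assms(2,3)]) (auto intro: finite_subset)
  have sub: "?T \<subseteq> ?S k" for k by (auto simp: missed_def)
  have "real n * prob ?T = (\<Sum>k\<in>?I. prob ?T)" by simp
  also have "\<dots> \<le> (\<Sum>k\<in>?I. prob (?S k))"
    using sub meas by (intro sum_mono finite_measure_mono) auto
  finally show "cond_missing_mass M d n x r \<le> loo_missing_mass M d n x r"
    using assms(4) by (simp add: cond_missing_mass_def loo_missing_mass_def field_simps)
  have "(\<Sum>k\<in>?I. prob (?S k) - prob ?T) = (\<Sum>k\<in>?I. prob (?S k - ?T))"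
    using sub meas by (intro sum.cong refl finite_measure_Diff[symmetric]) auto
  also have "\<dots> = prob (\<Union>k\<in>?I. ?S k - ?T)"
  proof (rule finite_measure_finite_Union[symmetric])
    show "disjoint_family_on (\<lambda>k. ?S k - ?T) ?I"
      by (auto simp: disjoint_family_on_def missed_def)
  qed (use meas in auto)
  also have "\<dots> \<le> 1" by simp
  finally show "loo_missing_mass M d n x r \<le> cond_missing_mass M d n x r + 1 / real n"
    using assms(4) by (simp add: cond_missing_mass_def loo_missing_mass_def sum_subtractf field_simps)
qed

section \<open>The four estimates for the Good-Turing estimator\<close>

theorem theorem2p1:
  fixes \<mu> :: "'a::t2_space measure"
    and d :: "'a \<Rightarrow> 'a \<Rightarrow> real"
    and P :: "'b measure"
    and X :: "nat \<Rightarrow> 'b \<Rightarrow> 'a"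
    and n :: nat
    and r :: real
  assumes "prob_space \<mu>" and "sets \<mu> = sets borel"
    and "distortion d"
    and "n \<ge> 1" and "r \<ge> 0"
    and "ball_relation_measurable \<mu> d r"
    and "prob_space P"
    and "prob_space.indep_vars P (\<lambda>_. borel) X {1..n}"
    and "\<And>k. k \<in> {1..n} \<Longrightarrow> distr P borel (X k) = \<mu>"
  defines "Mhat \<equiv> \<lambda>\<omega>. cond_missing_mass \<mu> d n (\<lambda>k. X k \<omega>) r"
    and "G \<equiv> \<lambda>\<omega>. good_turing d n (\<lambda>k. X k \<omega>) r"
    and "H \<equiv> \<lambda>\<omega>. loo_missing_mass \<mu> d n (\<lambda>k. X k \<omega>) r"
    and "M \<equiv> expected_missing_mass \<mu> d n r"
  shows "(\<forall>\<omega>\<in>space P. Mhat \<omega> \<le> H \<omega> \<and> H \<omega> \<le> Mhat \<omega> + 1 / real n) \<and>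
    (M \<le> prob_space.expectation (completion P) G \<and>
     prob_space.expectation (completion P) G \<le> M + 1 / real n) \<and>
    prob_space.variance (completion P) (\<lambda>\<omega>. G \<omega> - H \<omega>) \<le> 3 / real n \<and>
    L2_norm_rv (completion P) (\<lambda>\<omega>. G \<omega> - Mhat \<omega>) \<le> sqrt (7 / real n)"
proof -
  note [simp del] = One_nat_def \<comment> \<open>the simplifier would rewrite the locale parameter \<open>{1..n}\<close>\<close>
  let ?I = "{1..n}"
  let ?Q = "PiM ?I (\<lambda>_. \<mu>)"
  interpret mu: prob_space \<mu> by fact
  interpret P: prob_space P by fact
  have n: "real n \<ge> 1" using assms(4) by simp
  have space_mu: "space \<mu> = UNIV"
    using sets_eq_imp_space_eq[OF assms(2)] by simp
  \<comment> \<open>A set of the completed sigma-algebra is a measurable set \<open>E\<close> up to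
    part of a null set; \<open>E\<close> serves as the covering relation.\<close>
  obtain E N N' where EN: "{(x, y). d x y \<le> r} = E \<union> N" "N \<subseteq> N'"
    and N': "N' \<in> null_sets (\<mu> \<Otimes>\<^sub>M \<mu>)" and E: "E \<in> sets (\<mu> \<Otimes>\<^sub>M \<mu>)"
    using assms(6) unfolding ball_relation_measurable_def by (rule sets_completionE)
  interpret relation_sample \<mu> E ?I
    by standard (use E in auto)
  have ae_E: "AE p in \<mu> \<Otimes>\<^sub>M \<mu>. p \<in> E \<longleftrightarrow> d (fst p) (snd p) \<le> r"
    using AE_not_in[OF N'] by eventually_elim (use EN in auto)

  \<comment> \<open>\<open>g\<close>, \<open>h\<close> and \<open>m\<close> are measurable versions
    of \<open>G\<close>, \<open>H\<close> and \<open>Mhat\<close> on the space of samples.\<close>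
  define g where "g = (\<lambda>x. 1 / real n * (\<Sum>k\<in>?I. hit (uncovered (?I - {k})) k x))"
  define h where "h = (\<lambda>x. 1 / real n * (\<Sum>k\<in>?I. mass (uncovered (?I - {k})) x))"
  define m where "m = mass (uncovered ?I)"
  have g_meas [measurable]: "g \<in> borel_measurable ?Q"
    unfolding g_def by (intro borel_measurable_times borel_measurable_sum measurable_hit sets_uncovered) auto
  have h_meas [measurable]: "h \<in> borel_measurable ?Q"
    unfolding h_def by (intro borel_measurable_times borel_measurable_sum measurable_mass sets_uncovered) auto
  have m_meas [measurable]: "m \<in> borel_measurable ?Q"
    unfolding m_def by (intro measurable_mass sets_uncovered) auto

  \<comment> \<open>Hits compare two distinct sample points; masses compare a sample point with
    almost every point of the space. Each needs its own null set.\<close>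
  have "AE x in ?Q. \<forall>i\<in>?I. \<forall>k\<in>?I. i \<noteq> k \<longrightarrow> ((x i, x k) \<in> E \<longleftrightarrow> d (x i) (x k) \<le> r)"
    using mu.AE_PiM_pair[OF _ _ _ _ ae_E, of ?I] by (intro AE_finite_allI) auto
  moreover have "AE x in ?Q. \<forall>i\<in>?I. AE y in \<mu>. (x i, y) \<in> E \<longleftrightarrow> d (x i) y \<le> r"
    using mu.AE_PiM_section[OF _ ae_E, of _ ?I] by (intro AE_finite_allI) auto
  ultimately have ae: "AE x in ?Q. good_turing d n x r = g x \<and> loo_missing_mass \<mu> d n x r = h x \<and>
      cond_missing_mass \<mu> d n x r = m x"
    using AE_space
  proof eventually_elim
    case (elim x)
    have mass_eq: "measure \<mu> (missed d J x r) = mass (uncovered J) x" if J: "J \<subseteq> ?I" for J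
      unfolding mass_def
    proof (rule mu.finite_measure_eq_AE)
      have fin: "finite J" using J by (rule finite_subset) simp
      have "AE y in \<mu>. \<forall>i\<in>J. (x i, y) \<in> E \<longleftrightarrow> d (x i) y \<le> r"
        using elim(2) J by (intro AE_finite_allI fin) auto
      then show "AE y in \<mu>. y \<in> missed d J x r \<longleftrightarrow> y \<in> Pair x -` uncovered J"
        by eventually_elim
          (use elim(3) in \<open>auto simp: missed_def dist_ball_def uncovered_def space_pair_measure space_mu\<close>)
      show "missed d J x r \<in> sets \<mu>" by (rule sets_missed[OF assms(3,2) fin])
      show "Pair x -` uncovered J \<in> sets \<mu>" using J by (intro sets_Pair1[OF sets_uncovered])
    qed
    have hit_eq: "indicator (missed d (?I - {k}) x r) (x k) = hit (uncovered (?I - {k})) k x"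
      if "k \<in> ?I" for k
      using elim(1,3) that
      by (auto simp: missed_def dist_ball_def uncovered_def space_pair_measure space_mu hit_def indicator_def)
    show ?case
      unfolding good_turing_def loo_missing_mass_def cond_missing_mass_def g_def h_def m_def
      using mass_eq hit_eq by (auto intro!: arg_cong[where f = "\<lambda>s. s / real n"] sum.cong)
  qed

  \<comment> \<open>Elements of the product space are \<open>undefined\<close> outside the index
    set, hence the restriction; the estimators read only indices from 1 to n.\<close>
  define V where "V = (\<lambda>\<omega>. \<lambda>i\<in>?I. X i \<omega>)"
  have rv: "X i \<in> P \<rightarrow>\<^sub>M borel" if "i \<in> ?I" for i
    using assms(8) that unfolding P.indep_vars_def by auto
  have V: "V \<in> P \<rightarrow>\<^sub>M PiM ?I (\<lambda>_. borel)"
    unfolding V_def using rv by (intro measurable_restrict) auto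
  have distr_V: "distr P (PiM ?I (\<lambda>_. borel)) V = ?Q"
  proof -
    have "distr P (PiM ?I (\<lambda>_. borel)) V = PiM ?I (\<lambda>i. distr P borel (X i))"
      unfolding V_def using P.indep_vars_iff_distr_eq_PiM'[OF _ rv, of ?I] assms(4,8) by simp
    also have "\<dots> = ?Q"
      by (intro PiM_cong refl assms(9))
    finally show ?thesis .
  qed
  have G_V: "G \<omega> = good_turing d n (V \<omega>) r" for \<omega>
    unfolding G_def good_turing_def V_def
    by (auto intro!: arg_cong[where f = "\<lambda>s. s / real n"] sum.cong arg_cong2[where f = indicator] missed_cong)
  have H_V: "H \<omega> = loo_missing_mass \<mu> d n (V \<omega>) r" for \<omega>
    unfolding H_def loo_missing_mass_def V_def
    by (auto intro!: arg_cong[where f = "\<lambda>s. s / real n"] sum.cong arg_cong[where f = "measure \<mu>"] missed_cong)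
  have M_V: "Mhat \<omega> = cond_missing_mass \<mu> d n (V \<omega>) r" for \<omega>
    unfolding Mhat_def cond_missing_mass_def V_def
    by (auto intro!: arg_cong[where f = "measure \<mu>"] missed_cong)
  note transfer = integral_completion_distr_AE[OF V distr_V]

  have mean01: "0 \<le> 1 / real n * (\<Sum>k\<in>?I. f k) \<and> 1 / real n * (\<Sum>k\<in>?I. f k) \<le> 1"
    if "\<And>k. 0 \<le> f k" "\<And>k. f k \<le> 1" for f :: "nat \<Rightarrow> real"
  proof -
    have "(\<Sum>k\<in>?I. f k) \<le> (\<Sum>k\<in>?I. 1)" by (rule sum_mono) (rule that(2))
    moreover have "0 \<le> (\<Sum>k\<in>?I. f k)" by (rule sum_nonneg) (rule that(1))
    ultimately show ?thesis using n by simp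
  qed
  have g01: "0 \<le> g x \<and> g x \<le> 1" for x
    unfolding g_def by (rule mean01) (rule hit_bounds)+
  have h01: "0 \<le> h x \<and> h x \<le> 1" for x
    unfolding h_def by (rule mean01) (rule mass_bounds)+
  have m01: "0 \<le> m x \<and> m x \<le> 1" for x
    unfolding m_def using mass_bounds by auto
  have g_int: "integrable ?Q g" and h_int: "integrable ?Q h" and m_int: "integrable ?Q m"
    using g01 h01 m01 by (auto intro!: integrable_bounded[where B = 1])
  have hm: "AE x in ?Q. m x \<le> h x \<and> h x \<le> m x + 1 / real n"
    using ae by eventually_elim
      (use missing_mass_leave_one_out[OF assms(1,3,2,4)] in metis)

  have gh: "g x - h x = 1 / real n * (\<Sum>k\<in>?I. dev (uncovered (?I - {k})) k x)" for x
    by (simp add: g_def h_def dev_def sum_subtractf right_diff_distrib diff_divide_distrib)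
  have gh_0: "(\<integral>x. g x - h x \<partial>?Q) = 0"
  proof -
    have dev_int: "integrable ?Q (dev (uncovered (?I - {k})) k)" if "k \<in> ?I" for k
      using that abs_dev_le
      by (intro integrable_bounded[where B = 1] measurable_dev sets_uncovered) auto
    have "(\<integral>x. g x - h x \<partial>?Q) = 1 / real n * (\<Sum>k\<in>?I. \<integral>x. dev (uncovered (?I - {k})) k x \<partial>?Q)"
      unfolding gh using dev_int by (simp add: Bochner_Integration.integral_sum)
    also have "(\<Sum>k\<in>?I. \<integral>x. dev (uncovered (?I - {k})) k x \<partial>?Q) = 0"
      by (intro sum.neutral ballI integral_dev_eq_0 sets_uncovered ignores_uncovered) auto
    finally show ?thesis by simp
  qed
  have gh_2: "(\<integral>x. (g x - h x)\<^sup>2 \<partial>?Q) \<le> 2 / real n"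
  proof -
    have "(\<integral>x. (g x - h x)\<^sup>2 \<partial>?Q)
        = 1 / (real n)\<^sup>2 * (\<integral>x. (\<Sum>k\<in>?I. dev (uncovered (?I - {k})) k x)\<^sup>2 \<partial>?Q)"
      unfolding gh by (simp add: power_divide)
    also have "\<dots> \<le> 1 / (real n)\<^sup>2 * (2 * real n)"
      using integral_sum_dev_square_le by (intro mult_left_mono) auto
    also have "\<dots> = 2 / real n" by (simp add: power2_eq_square)
    finally show ?thesis .
  qed

  have EG: "integral\<^sup>L (completion P) G = (\<integral>x. g x \<partial>?Q)"
    unfolding G_V[abs_def] by (rule transfer[OF g_meas]) (use ae in auto)
  \<comment> \<open>As \<open>g - h\<close> has mean 0, estimate (ii) is the expectation of
    (i).\<close>
  have EG_h: "(\<integral>x. g x \<partial>?Q) = (\<integral>x. h x \<partial>?Q)"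
    using gh_0 g_int h_int by simp
  \<comment> \<open>\<open>expected_missing_mass\<close> already lives on the completed product, so
    the transfer uses the identity map.\<close>
  have EM: "M = (\<integral>x. m x \<partial>?Q)"
    unfolding M_def expected_missing_mass_def
    using integral_completion_distr_AE[OF measurable_ident_sets[OF refl] distr_id m_meas, of "\<lambda>x. cond_missing_mass \<mu> d n x r"] ae
    by auto
  have "M \<le> integral\<^sup>L (completion P) G"
    unfolding EM EG EG_h using hm by (intro integral_mono_AE m_int h_int) auto
  moreover have "integral\<^sup>L (completion P) G \<le> M + 1 / real n"
  proof -
    have "(\<integral>x. h x \<partial>?Q) \<le> (\<integral>x. m x + 1 / real n \<partial>?Q)"
      using hm m_int h_int by (intro integral_mono_AE) auto
    then show ?thesis
      unfolding EM EG EG_h using m_int by (simp add: Q.P.prob_space)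
  qed
  moreover have "prob_space.variance (completion P) (\<lambda>\<omega>. G \<omega> - H \<omega>) \<le> 3 / real n"
  proof -
    \<comment> \<open>The mean is 0, so the variance is the second moment, at most 2/n.\<close>
    have "(\<integral>\<omega>. G \<omega> - H \<omega> \<partial>completion P) = (\<integral>x. g x - h x \<partial>?Q)"
      unfolding G_V H_V by (rule transfer) (use ae in auto)
    moreover have "(\<integral>\<omega>. (G \<omega> - H \<omega>)\<^sup>2 \<partial>completion P) = (\<integral>x. (g x - h x)\<^sup>2 \<partial>?Q)"
      unfolding G_V H_V by (rule transfer) (use ae in auto)
    ultimately show ?thesis
      using gh_0 gh_2 n by (simp add: field_simps)
  qed
  moreover have "L2_norm_rv (completion P) (\<lambda>\<omega>. G \<omega> - Mhat \<omega>) \<le> sqrt (7 / real n)"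
  proof -
    have abs1: "\<bar>g x - m x\<bar> \<le> 1" "\<bar>g x - h x\<bar> \<le> 1" for x
      using g01[of x] h01[of x] m01[of x] by linarith+
    have gh_int: "integrable ?Q (\<lambda>x. (g x - h x)\<^sup>2)"
      using abs1 by (intro integrable_bounded[where B = 1]) (auto simp: abs_square_le_1)
    have "(\<integral>\<omega>. (G \<omega> - Mhat \<omega>)\<^sup>2 \<partial>completion P) = (\<integral>x. (g x - m x)\<^sup>2 \<partial>?Q)"
      unfolding G_V M_V by (rule transfer) (use ae in auto)
    \<comment> \<open>With u = g - h and v = h - m, this is (u + v)^2 <= 2u^2 + 2v^2 together with
      |v| <= 1/n from (i). Its integral is at most 4/n + 2/n^2, which lies below 7/n.\<close>
    also have "\<dots> \<le> (\<integral>x. 2 * (g x - h x)\<^sup>2 + 2 / (real n)\<^sup>2 \<partial>?Q)"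
    proof (rule integral_mono_AE)
      show "integrable ?Q (\<lambda>x. (g x - m x)\<^sup>2)"
        using abs1 by (intro integrable_bounded[where B = 1]) (auto simp: abs_square_le_1)
      show "integrable ?Q (\<lambda>x. 2 * (g x - h x)\<^sup>2 + 2 / (real n)\<^sup>2)"
        using gh_int by simp
      show "AE x in ?Q. (g x - m x)\<^sup>2 \<le> 2 * (g x - h x)\<^sup>2 + 2 / (real n)\<^sup>2"
        using hm
      proof eventually_elim
        case (elim x)
        then have "(h x - m x)\<^sup>2 \<le> (1 / real n)\<^sup>2"
          by (intro power_mono) auto
        moreover have "(g x - m x)\<^sup>2 \<le> 2 * (g x - h x)\<^sup>2 + 2 * (h x - m x)\<^sup>2"
          using zero_le_power2[of "(g x - h x) - (h x - m x)"] by (simp add: power2_eq_square algebra_simps)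
        ultimately show ?case by (simp add: power_divide)
      qed
    qed
    also have "\<dots> = 2 * (\<integral>x. (g x - h x)\<^sup>2 \<partial>?Q) + 2 / (real n)\<^sup>2"
      using gh_int by (simp add: Q.P.prob_space)
    also have "\<dots> \<le> 2 * (2 / real n) + 2 / real n"
    proof (intro add_mono mult_left_mono gh_2)
      show "2 / (real n)\<^sup>2 \<le> 2 / real n"
        using n by (simp add: power2_eq_square field_simps)
    qed simp
    also have "\<dots> \<le> 7 / real n" using n by (simp add: field_simps)
    finally show ?thesis unfolding L2_norm_rv_def by (rule real_sqrt_le_mono)
  qed
  moreover have "\<forall>\<omega>\<in>space P. Mhat \<omega> \<le> H \<omega> \<and> H \<omega> \<le> Mhat \<omega> + 1 / real n"
    unfolding Mhat_def H_def using missing_mass_leave_one_out[OF assms(1,3,2,4)] by blast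
  ultimately show ?thesis by blast
qed

end
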